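(* Fix an integer $r\ge3$ and a real number $s$ with $1<s<\frac{r}{r-1}$, and set $M=\left\lceil \frac{s}{r-(r-1)s}\right\rceil$. Then $t_r(n,d,s)\le (r-1)M+1$ for every $n$ and every $d\ge s$. Moreover, $t_r(n,s,s)=(r-1)M+1$ for all sufficiently large $n$.
   Context: An $r$-graph ($r$-uniform hypergraph) is a pair $H=(V(H),E(H))$ with $V(H)$ a finite set and $E(H)\subseteq\binom{V(H)}{r}$; $e(H)=|E(H)|$. An $r$-graph $F$ is a subhypergraph of $H$ if $V(F)\subseteq V(H)$ and $E(F)\subseteq E(H)$. The average degree of an $r$-graph $H$ with nonempty vertex set is $\overline d(H)=r\,e(H)/|V(H)|$. For real numbers $d\ge s>1$, $t_r(n,d,s)$ denotes the smallest integer $t$ such that every $n$-vertex $r$-graph $H$ with $\overline d(H)\ge d$ contains a nonempty subhypergraph $H'$ with $|V(H')|\le t$ and $\overline d(H')\ge s$. It is considered only for pairs $(n,d)$ for which at least one $n$-vertex $r$-graph of average degree at least $d$ exists, i.e. $d\le\binom{n-1}{r-1}$. *)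

theory Defs
  imports Complex_Main "HOL-Library.Ramsey"
begin

type_synonym 'a hypergraph = "'a set \<times> 'a set set"

abbreviation verts :: "'a hypergraph \<Rightarrow> 'a set" where "verts \<equiv> fst"
abbreviation edges :: "'a hypergraph \<Rightarrow> 'a set set" where "edges \<equiv> snd"

definition r_graph :: "nat \<Rightarrow> 'a hypergraph \<Rightarrow> bool" where
  "r_graph r H \<longleftrightarrow> finite (verts H) \<and> edges H \<subseteq> [verts H]\<^bsup>r\<^esup>"

definition subhypergraph :: "'a hypergraph \<Rightarrow> 'a hypergraph \<Rightarrow> bool" where
  "subhypergraph F H \<longleftrightarrow> verts F \<subseteq> verts H \<and> edges F \<subseteq> edges H"

(* Only meaningful for a nonempty vertex set; otherwise x / 0 = 0 applies. *)
definition avg_degree :: "nat \<Rightarrow> 'a hypergraph \<Rightarrow> real" where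
  "avg_degree r H = real r * real (card (edges H)) / real (card (verts H))"

(* Every finite hypergraph is isomorphic to one whose vertices are natural numbers,
   so it is enough to let H range over hypergraphs of that kind. *)
definition small_dense_sub :: "nat \<Rightarrow> nat \<Rightarrow> real \<Rightarrow> real \<Rightarrow> nat \<Rightarrow> bool" where
  "small_dense_sub r n d s t \<longleftrightarrow>
     (\<forall>H :: nat hypergraph. r_graph r H \<and> card (verts H) = n \<and> d \<le> avg_degree r H \<longrightarrow>
        (\<exists>H'. r_graph r H' \<and> subhypergraph H' H \<and> verts H' \<noteq> {} \<and>
              card (verts H') \<le> t \<and> s \<le> avg_degree r H'))"

(* The parameters are meant to satisfy 1 < s \<le> d \<le> (n - 1) choose (r - 1).  The last
   inequality says that some n-vertex r-graph has average degree at least d (see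
   ex_r_graph_avg_degree_iff); without it small_dense_sub is vacuous and the value is 0.
   The range of t is nat because no negative t can work when such an r-graph exists. *)
definition t_num :: "nat \<Rightarrow> nat \<Rightarrow> real \<Rightarrow> real \<Rightarrow> nat" where
  "t_num r n d s = (LEAST t. small_dense_sub r n d s t)"

lemma small_dense_sub_t_num:
  assumes "1 < s" "s \<le> d"
  shows "small_dense_sub r n d s (t_num r n d s)"
proof -
  have "small_dense_sub r n d s n"
    unfolding small_dense_sub_def
  proof (intro allI impI)
    fix H :: "nat hypergraph"
    assume H: "r_graph r H \<and> card (verts H) = n \<and> d \<le> avg_degree r H"
    have "verts H \<noteq> {}"
      using H assms by (auto simp: avg_degree_def)
    then show "\<exists>H'. r_graph r H' \<and> subhypergraph H' H \<and> verts H' \<noteq> {} \<and>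
        card (verts H') \<le> n \<and> s \<le> avg_degree r H'"
      using H assms by (intro exI[of _ H]) (auto simp: subhypergraph_def)
  qed
  then show ?thesis
    unfolding t_num_def by (rule LeastI)
qed

lemma ex_r_graph_avg_degree_iff:
  assumes "1 \<le> r" "1 \<le> n"
  shows "(\<exists>H :: nat hypergraph. r_graph r H \<and> card (verts H) = n \<and> d \<le> avg_degree r H)
    \<longleftrightarrow> d \<le> real ((n - 1) choose (r - 1))"
proof -
  have "r * (n choose r) = n * ((n - 1) choose (r - 1))"
    using times_binomial_minus1_eq[of r n] assms by simp
  then have "real r * real (n choose r) = real n * real ((n - 1) choose (r - 1))"
    by (metis of_nat_mult)
  then have eq: "real r * real (n choose r) / real n = real ((n - 1) choose (r - 1))"
    using assms by simp
  show ?thesis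
  proof
    assume "\<exists>H :: nat hypergraph. r_graph r H \<and> card (verts H) = n \<and> d \<le> avg_degree r H"
    then obtain H :: "nat hypergraph" where
      H: "finite (verts H)" "edges H \<subseteq> [verts H]\<^bsup>r\<^esup>" "card (verts H) = n" "d \<le> avg_degree r H"
      by (auto simp: r_graph_def)
    have "card (edges H) \<le> n choose r"
      using card_mono[OF finite_imp_finite_nsets[OF H(1)] H(2)] H(3) by simp
    then have "avg_degree r H \<le> real r * real (n choose r) / real n"
      unfolding avg_degree_def H(3) by (intro divide_right_mono mult_left_mono) auto
    then show "d \<le> real ((n - 1) choose (r - 1))"
      using H(4) eq by simp
  next
    assume d: "d \<le> real ((n - 1) choose (r - 1))"
    let ?H = "({..<n}, [{..<n}]\<^bsup>r\<^esup>) :: nat hypergraph"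
    have "r_graph r ?H" "card (verts ?H) = n" "d \<le> avg_degree r ?H"
      using d eq by (auto simp: r_graph_def avg_degree_def)
    then show "\<exists>H :: nat hypergraph. r_graph r H \<and> card (verts H) = n \<and> d \<le> avg_degree r H"
      by blast
  qed
qed

end

theory Submission
  imports Defs
begin

text \<open>
  An edge set grown by repeatedly adding an edge that meets its union has at most
  \<open>(r - 1) k + 1\<close> vertices when it has \<open>k\<close> edges, with equality for
  hypertrees; and \<open>r k \<ge> s ((r - 1) k + 1)\<close> holds exactly if \<open>k \<ge> M\<close>.
  For the upper bound, grow such a set until it has \<open>M\<close> edges. If it gets stuck earlier, it is a
  union of components, and either it or the rest of the hypergraph has average degree at least
  \<open>s\<close>. For the lower bound, take a sunflower with a one-point kernel that covers all but
  fewer than \<open>r - 1\<close> vertices: its average degree tends to \<open>r / (r - 1) > s\<close>, and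
  \<open>k\<close> of its edges always span at least \<open>(r - 1) k + 1\<close> vertices.
\<close>

section \<open>Basic facts and the upper bound: growing edge sets\<close>

lemma avg_degree_ge_iff:
  assumes "finite (verts H)" "verts H \<noteq> {}"
  shows "s \<le> avg_degree r H \<longleftrightarrow> s * real (card (verts H)) \<le> real r * real (card (edges H))"
proof -
  have "0 < card (verts H)"
    using assms by (simp add: card_gt_0_iff)
  then show ?thesis
    by (simp add: avg_degree_def pos_le_divide_eq)
qed

lemma r_graph_finite_edges:
  assumes "r_graph r H"
  shows "finite (edges H)"
  using assms finite_imp_finite_nsets finite_subset unfolding r_graph_def by metis

lemma r_graph_verts_nonempty:
  assumes "r_graph r H" "edges H \<noteq> {}" "1 \<le> r"
  shows "verts H \<noteq> {}"
proof -
  obtain e where "e \<in> edges H"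
    using assms(2) by blast
  then have "e \<subseteq> verts H" "card e = r"
    using assms(1) by (auto simp: r_graph_def nsets_def)
  then show ?thesis
    using assms(3) by auto
qed

text \<open>The first edge has \<open>r\<close> vertices, and every later edge meets the union built
  so far, so it adds at most \<open>r - 1\<close> new ones. Once no further edge meets the union,
  the same \<open>A\<close> serves for all larger \<open>k\<close>.\<close>

lemma ex_grown_edge_set:
  assumes H: "r_graph r H" and "edges H \<noteq> {}" "1 \<le> r" "1 \<le> k"
  shows "\<exists>A \<subseteq> edges H. A \<noteq> {} \<and> card A \<le> k \<and> card (\<Union>A) \<le> (r - 1) * card A + 1 \<and>
    (card A = k \<or> (\<forall>f \<in> edges H - A. f \<inter> \<Union>A = {}))"
  using \<open>1 \<le> k\<close>
proof (induction k rule: dec_induct)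
  case base
  obtain e where e: "e \<in> edges H"
    using assms(2) by blast
  then have "card e = r"
    using H by (auto simp: r_graph_def nsets_def)
  then show ?case
    using e \<open>1 \<le> r\<close> by (intro exI[of _ "{e}"]) auto
next
  case (step k)
  then obtain A where A: "A \<subseteq> edges H" "A \<noteq> {}" "card A \<le> k"
    "card (\<Union>A) \<le> (r - 1) * card A + 1" "card A = k \<or> (\<forall>f \<in> edges H - A. f \<inter> \<Union>A = {})"
    by blast
  show ?case
  proof (cases "\<forall>f \<in> edges H - A. f \<inter> \<Union>A = {}")
    case True
    then show ?thesis
      using A by (intro exI[of _ A]) auto
  next
    case False
    then obtain f where f: "f \<in> edges H" "f \<notin> A" "f \<inter> \<Union>A \<noteq> {}"
      by blast
    have k: "card A = k"
      using A False by blast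
    have "finite A"
      using A(1) r_graph_finite_edges[OF H] finite_subset by blast
    then have cardI: "card (insert f A) = Suc k"
      using f k by simp
    have cf: "card f = r" "finite f"
      using f H by (auto simp: r_graph_def nsets_def)
    have "finite (\<Union>A)"
      using A(1) H by (intro finite_subset[of "\<Union>A" "verts H"]) (auto simp: r_graph_def nsets_def)
    then have "card (f \<union> \<Union>A) + card (f \<inter> \<Union>A) = r + card (\<Union>A)"
      using card_Un_Int[of f "\<Union>A"] cf by simp
    moreover have "1 \<le> card (f \<inter> \<Union>A)"
      using f(3) cf(2) by (simp add: Suc_le_eq card_gt_0_iff)
    ultimately have "card (\<Union>(insert f A)) \<le> (r - 1) * Suc k + 1"
      using A(4) k \<open>1 \<le> r\<close> by simp
    then show ?thesis
      using A(1) f cardI by (intro exI[of _ "insert f A"]) auto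
  qed
qed

text \<open>The inequality on \<open>k\<close> says that \<open>k\<close> edges on at most
  \<open>(r - 1) * k + 1\<close> vertices reach average degree \<open>s\<close>. If the grown set is
  too sparse, it is removed together with its vertices, and induction on the number of vertices
  applies to the rest.\<close>

lemma ex_dense_subhypergraph:
  fixes s :: real
  assumes "0 < s" "1 \<le> r" "1 \<le> k" and k: "s * real ((r - 1) * k + 1) \<le> real r * real k"
    and "r_graph r H" "s \<le> avg_degree r H"
  shows "\<exists>H'. r_graph r H' \<and> subhypergraph H' H \<and> verts H' \<noteq> {} \<and>
    card (verts H') \<le> (r - 1) * k + 1 \<and> s \<le> avg_degree r H'"
  using assms(5,6)
proof (induction "card (verts H)" arbitrary: H rule: less_induct)
  case less
  note H = less.prems(1)
  have finV: "finite (verts H)" and finE: "finite (edges H)"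
    using H r_graph_finite_edges[OF H] by (simp_all add: r_graph_def)
  have "verts H \<noteq> {}" "edges H \<noteq> {}"
    using less.prems(2) \<open>0 < s\<close> by (auto simp: avg_degree_def)
  then have dense: "s * real (card (verts H)) \<le> real r * real (card (edges H))"
    using avg_degree_ge_iff[OF finV] less.prems(2) by blast
  obtain A where A: "A \<subseteq> edges H" "A \<noteq> {}" "card A \<le> k"
    "card (\<Union>A) \<le> (r - 1) * card A + 1" "card A = k \<or> (\<forall>f \<in> edges H - A. f \<inter> \<Union>A = {})"
    using ex_grown_edge_set[OF H \<open>edges H \<noteq> {}\<close> \<open>1 \<le> r\<close> \<open>1 \<le> k\<close>] by blast
  let ?H1 = "(\<Union>A, A)" and ?H2 = "(verts H - \<Union>A, edges H - A)"
  have sub: "\<Union>A \<subseteq> verts H"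
    using A(1) H by (auto simp: r_graph_def nsets_def)
  have finU: "finite (\<Union>A)"
    using sub finV finite_subset by blast
  have H1: "r_graph r ?H1" "subhypergraph ?H1 H"
    using A(1) H sub finU by (auto simp: r_graph_def nsets_def subhypergraph_def)
  have ne: "\<Union>A \<noteq> {}"
    using r_graph_verts_nonempty[OF H1(1)] A(2) \<open>1 \<le> r\<close> by simp
  have small: "card (\<Union>A) \<le> (r - 1) * k + 1"
    using A(3,4) by (meson add_le_mono1 le_trans mult_le_mono2)
  show ?case
  proof (cases "s \<le> avg_degree r ?H1")
    case True
    then show ?thesis
      using H1 ne small by (intro exI[of _ ?H1]) simp
  next
    case False
    then have sparse: "real r * real (card A) < s * real (card (\<Union>A))"
      using avg_degree_ge_iff[of ?H1 s r] ne finU by simp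
    \<comment> \<open>With \<open>k\<close> edges \<open>?H1\<close> would be dense. Hence growth
      got stuck, all other edges avoid \<open>\<Union>A\<close>, and so \<open>?H2\<close> is an
      r-graph.\<close>
    have "card A \<noteq> k"
    proof
      assume "card A = k"
      then have "s * real (card (\<Union>A)) \<le> s * real ((r - 1) * k + 1)"
        using small \<open>0 < s\<close> by (intro mult_left_mono) (auto simp del: of_nat_add of_nat_mult)
      then show False
        using k sparse \<open>card A = k\<close> by simp
    qed
    then have "\<forall>f \<in> edges H - A. f \<inter> \<Union>A = {}"
      using A(5) by blast
    then have H2: "r_graph r ?H2" "subhypergraph ?H2 H"
      using H by (auto simp: r_graph_def nsets_def subhypergraph_def)
    have cV: "card (verts H) = card (\<Union>A) + card (verts ?H2)"
      using card_Un_disjoint[of "\<Union>A" "verts H - \<Union>A"] sub finV finU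
      by (simp add: Un_absorb1)
    have cE: "card (edges H) = card A + card (edges ?H2)"
      using card_Un_disjoint[of A "edges H - A"] A(1) finE
        finite_subset[OF A(1) finE]
      by (simp add: Un_absorb1)
    \<comment> \<open>The average degree of \<open>H\<close> is a weighted mean of those of the two
      pieces. The division-free form is used because \<open>verts ?H2\<close> is not yet known to be
      nonempty; the strict inequality yields an edge of \<open>?H2\<close>, and thus a
      vertex.\<close>
    have dense2: "s * real (card (verts ?H2)) < real r * real (card (edges ?H2))"
      using dense sparse unfolding cV cE by (simp add: algebra_simps)
    moreover have "0 \<le> s * real (card (verts ?H2))"
      using \<open>0 < s\<close> by simp
    ultimately have "0 < real r * real (card (edges ?H2))"
      by linarith
    then have "edges ?H2 \<noteq> {}"
      by (metis card.empty less_irrefl mult_zero_right of_nat_0)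
    then have "verts ?H2 \<noteq> {}"
      using r_graph_verts_nonempty[OF H2(1)] \<open>1 \<le> r\<close> by blast
    then have "s \<le> avg_degree r ?H2"
      using dense2 avg_degree_ge_iff[of ?H2 s r] finV by simp
    moreover have "card (verts ?H2) < card (verts H)"
      using cV ne finU by (simp add: card_gt_0_iff)
    ultimately obtain H' where "r_graph r H'" "subhypergraph H' ?H2" "verts H' \<noteq> {}"
      "card (verts H') \<le> (r - 1) * k + 1" "s \<le> avg_degree r H'"
      using less.hyps[OF _ H2(1)] by blast
    then show ?thesis
      using H2(2) by (intro exI[of _ H']) (auto simp: subhypergraph_def)
  qed
qed

section \<open>Lower bound: sunflowers with a one-point kernel\<close>

definition petal :: "nat \<Rightarrow> nat \<Rightarrow> nat set" where
  "petal q i = {q * i + 1..<q * i + 1 + q}"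

lemma disjoint_petals:
  assumes "i \<noteq> j"
  shows "petal q i \<inter> petal q j = {}"
proof -
  have "petal q i \<inter> petal q j = {}" if "i < j" for i j
  proof -
    have "q * i + q \<le> q * j"
      using that mult_le_mono2[of "Suc i" j q] by simp
    then show ?thesis
      by (auto simp: petal_def)
  qed
  then show ?thesis
    using assms by (metis inf_commute nat_neq_iff)
qed

lemma inj_sunflower:
  assumes "1 \<le> q"
  shows "inj (\<lambda>i. insert 0 (petal q i))"
proof (rule injI)
  fix i j assume "insert 0 (petal q i) = insert 0 (petal q j)"
  \<comment> \<open>The blocks start at 1, so 0 lies in neither petal and can be cancelled.\<close>
  then have "petal q i = petal q j"
    unfolding petal_def by (rule insert_ident[THEN iffD1, rotated 2]) auto
  moreover have "petal q i \<noteq> {}"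
    using assms by (simp add: petal_def)
  ultimately show "i = j"
    using disjoint_petals[of i j q] by blast
qed

lemma card_Union_sunflower:
  assumes "finite I" "I \<noteq> {}"
  shows "card (\<Union>i\<in>I. insert 0 (petal q i)) = q * card I + 1"
proof -
  have "(\<Union>i\<in>I. insert 0 (petal q i)) = insert 0 (\<Union>i\<in>I. petal q i)"
    using assms(2) by auto
  moreover have "card (\<Union>i\<in>I. petal q i) = (\<Sum>i\<in>I. card (petal q i))"
    using assms(1) disjoint_petals by (intro card_UN_disjoint) (auto simp: petal_def)
  moreover have "0 \<notin> (\<Union>i\<in>I. petal q i)" "finite (\<Union>i\<in>I. petal q i)"
    using assms(1) by (auto simp: petal_def)
  ultimately show ?thesis
    by (simp add: petal_def)
qed

text \<open>Vertex 0 is the kernel, and the other \<open>n - 1\<close> vertices are cut into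
  consecutive blocks of size \<open>r - 1\<close>. The leftover vertices stay isolated, so that the
  order is exactly \<open>n\<close>.\<close>

definition sunflower :: "nat \<Rightarrow> nat \<Rightarrow> nat hypergraph" where
  "sunflower r n = ({..<n}, (\<lambda>i. insert 0 (petal (r - 1) i)) ` {..<(n - 1) div (r - 1)})"

lemma r_graph_sunflower:
  assumes "1 \<le> r" "1 \<le> n"
  shows "r_graph r (sunflower r n)"
proof -
  have "insert 0 (petal (r - 1) i) \<in> [{..<n}]\<^bsup>r\<^esup>" if "i < (n - 1) div (r - 1)" for i
  proof -
    have "Suc i * (r - 1) \<le> (n - 1) div (r - 1) * (r - 1)"
      using that by (intro mult_le_mono1) simp
    also have "\<dots> \<le> n - 1"
      by simp
    finally have "(r - 1) * i + 1 + (r - 1) \<le> n"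
      using assms by (simp add: mult.commute)
    moreover have "card (insert 0 (petal (r - 1) i)) = r"
      using assms by (simp add: petal_def)
    ultimately show ?thesis
      using assms(2) by (auto simp: nsets_def petal_def)
  qed
  then show ?thesis
    by (auto simp: r_graph_def sunflower_def)
qed

text \<open>With \<open>m\<close> petals, n \<le> (r - 1)(m + 1), hence r m \<ge> n r/(r - 1) - r.
  This is at least s n once n (r/(r - 1) - s) \<ge> r, which is the assumed threshold for
  \<open>n\<close>.\<close>

lemma avg_degree_sunflower:
  assumes "2 \<le> r" "s < real r / (real r - 1)" "real r / (real r / (real r - 1) - s) \<le> real n" "1 \<le> n"
  shows "s \<le> avg_degree r (sunflower r n)"
proof -
  let ?m = "(n - 1) div (r - 1)"
  have "n - 1 < (r - 1) * ?m + (r - 1)"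
    using dividend_less_div_times[of "r - 1" "n - 1"] assms(1)
    by (simp add: mult.commute add.commute)
  then have "real n \<le> real ((r - 1) * ?m + (r - 1))"
    unfolding of_nat_le_iff using assms(4) by linarith
  also have "\<dots> = (real r - 1) * (real ?m + 1)"
    using assms(1) by (simp add: of_nat_diff distrib_left del: real_of_nat_div)
  finally have "real n / (real r - 1) \<le> real ?m + 1"
    using assms(1) by (simp add: pos_divide_le_eq mult.commute del: real_of_nat_div)
  then have "real r / (real r - 1) * real n \<le> real r * (real ?m + 1)"
    using mult_left_mono[of "real n / (real r - 1)" "real ?m + 1" "real r"] by simp
  moreover have "real r \<le> real n * (real r / (real r - 1) - s)"
    using assms(2,3) by (simp add: pos_divide_le_eq)
  ultimately have "s * real n \<le> real r * real ?m"
    by (simp add: algebra_simps del: real_of_nat_div)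
  moreover have "card (edges (sunflower r n)) = ?m"
    using inj_on_subset[OF inj_sunflower[of "r - 1"] subset_UNIV] assms(1)
    by (simp add: sunflower_def card_image)
  ultimately show ?thesis
    using assms(4) avg_degree_ge_iff[of "sunflower r n" s r]
    by (simp add: sunflower_def lessThan_empty_iff)
qed

text \<open>The edges of \<open>F\<close> form a smaller sunflower with the same kernel, whose union
  has exactly the size on the left; \<open>F\<close> may have isolated vertices besides.\<close>

lemma card_verts_sub_sunflower:
  assumes "2 \<le> r" and F: "r_graph r F" "subhypergraph F (sunflower r n)" "edges F \<noteq> {}"
  shows "(r - 1) * card (edges F) + 1 \<le> card (verts F)"
proof -
  obtain I where I: "I \<subseteq> {..<(n - 1) div (r - 1)}"
    "edges F = (\<lambda>i. insert 0 (petal (r - 1) i)) ` I"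
    using F(2) unfolding subhypergraph_def sunflower_def snd_conv subset_image_iff by blast
  have "finite I" "I \<noteq> {}"
    using I F(3) finite_subset[OF I(1)] by auto
  moreover have "card (edges F) = card I"
    unfolding I(2) using inj_on_subset[OF inj_sunflower[of "r - 1"] subset_UNIV] assms(1)
    by (simp add: card_image)
  ultimately have "(r - 1) * card (edges F) + 1 = card (\<Union>(edges F))"
    using card_Union_sunflower[of I "r - 1"] by (simp add: I(2))
  also have "\<dots> \<le> card (verts F)"
    using F(1) by (intro card_mono) (auto simp: r_graph_def nsets_def)
  finally show ?thesis .
qed

theorem theorem7:
  fixes r :: nat and s :: real and M :: int
  assumes "3 \<le> r"
    and "1 < s" and "s < real r / (real r - 1)"
    and "M = \<lceil>s / (real r - (real r - 1) * s)\<rceil>"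
  shows "(\<forall>(n::nat) (d::real). 1 \<le> n \<and> s \<le> d \<and> d \<le> real ((n - 1) choose (r - 1)) \<longrightarrow>
            int (t_num r n d s) \<le> (int r - 1) * M + 1)
    \<and> (\<forall>\<^sub>F n in sequentially. int (t_num r n s s) = (int r - 1) * M + 1)"
proof -
  have pos: "0 < real r - (real r - 1) * s"
    using assms(1,3) by (simp add: field_simps)
  define k where "k = nat M"
  have "0 < M"
    using assms(2,4) pos by simp
  then have M: "M = int k" "1 \<le> k"
    by (auto simp: k_def)
  \<comment> \<open>Rearranged, the inequality reads s \<le> j (r - (r - 1) s), so \<open>k\<close>
    is the least number of edges with which a hypertree reaches average degree \<open>s\<close>. The
    upper bound uses it at \<open>j = k\<close>, the lower bound at the number of edges of a dense
    subhypergraph.\<close>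
  have k_le_iff: "k \<le> j \<longleftrightarrow> s * real ((r - 1) * j + 1) \<le> real r * real j" for j
  proof -
    have "k \<le> j \<longleftrightarrow> M \<le> int j"
      by (simp add: M(1))
    also have "\<dots> \<longleftrightarrow> s / (real r - (real r - 1) * s) \<le> real j"
      unfolding assms(4) by (simp add: ceiling_le_iff)
    also have "\<dots> \<longleftrightarrow> s * real ((r - 1) * j + 1) \<le> real r * real j"
      using pos assms(1) by (simp add: pos_divide_le_eq of_nat_diff algebra_simps)
    finally show ?thesis .
  qed
  have bound: "(int r - 1) * M + 1 = int ((r - 1) * k + 1)"
    using assms(1) by (simp add: M(1) of_nat_diff)
  have upper: "t_num r n d s \<le> (r - 1) * k + 1" if "s \<le> d" for n d
  proof -
    have "small_dense_sub r n d s ((r - 1) * k + 1)"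
      unfolding small_dense_sub_def
      using ex_dense_subhypergraph[of s r k] k_le_iff[of k] assms(1,2) M(2) that by force
    then show ?thesis
      unfolding t_num_def by (rule Least_le)
  qed
  have lower: "(r - 1) * k + 1 \<le> t_num r n s s"
    if n: "real r / (real r / (real r - 1) - s) \<le> real n" "1 \<le> n" for n
  proof -
    have "r_graph r (sunflower r n)" "card (verts (sunflower r n)) = n"
      "s \<le> avg_degree r (sunflower r n)"
      using r_graph_sunflower[of r n] avg_degree_sunflower[of r s n] assms(1,3) n
      by (auto simp: sunflower_def)
    \<comment> \<open>The value \<open>t_num r n s s\<close> itself satisfies the defining property,
      so applying that property to the sunflower gives a dense \<open>F\<close> within this size.
      Density forces at least \<open>k\<close> edges, and these span at least
      \<open>(r - 1) * k + 1\<close> vertices.\<close>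
    then obtain F where F: "r_graph r F" "subhypergraph F (sunflower r n)" "verts F \<noteq> {}"
      "card (verts F) \<le> t_num r n s s" "s \<le> avg_degree r F"
      using small_dense_sub_t_num[OF assms(2) order_refl, of r n]
      unfolding small_dense_sub_def by blast
    have "edges F \<noteq> {}"
      using F(5) assms(2) by (auto simp: avg_degree_def)
    then have verts_F: "(r - 1) * card (edges F) + 1 \<le> card (verts F)"
      using card_verts_sub_sunflower F(1,2) assms(1) by force
    then have "s * real ((r - 1) * card (edges F) + 1) \<le> s * real (card (verts F))"
      using assms(2) by (intro mult_left_mono) (auto simp del: of_nat_add of_nat_mult)
    also have "\<dots> \<le> real r * real (card (edges F))"
      using avg_degree_ge_iff[of F s r] F(1,3,5) by (auto simp: r_graph_def)
    finally have "k \<le> card (edges F)"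
      by (simp add: k_le_iff)
    then have "(r - 1) * k + 1 \<le> (r - 1) * card (edges F) + 1"
      by simp
    then show ?thesis
      using verts_F F(4) by linarith
  qed
  have "\<forall>\<^sub>F n in sequentially. real r / (real r / (real r - 1) - s) \<le> real n"
    using filterlim_real_sequentially by (simp add: filterlim_at_top)
  then have "\<forall>\<^sub>F n in sequentially. int (t_num r n s s) = (int r - 1) * M + 1"
    using eventually_ge_at_top[of 1]
  proof eventually_elim
    case (elim n)
    then show ?case
      unfolding bound of_nat_eq_iff using upper[of s n] lower[of n] by (intro antisym) auto
  qed
  then show ?thesis
    unfolding bound of_nat_le_iff using upper by blast
qed

end
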